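(* Let $p\geq 1$ be an integer and let $G$ be a graph with $\alpha(G)\geq 2$. Then $G\in \mathbf{W}_{p}$ if and only if, for every $x\in V(G)$, $G_{x}\in \mathbf{W}_{p}$ and $\alpha(G_{x})=\alpha(G)-1$.
   Context: All graphs are finite, undirected, loopless and without multiple edges; $V(G)$ is the vertex set and $n(G)=|V(G)|$. An independent set is a set of pairwise non-adjacent vertices (the empty set is independent); $\alpha(G)$ is the largest cardinality of an independent set, and a maximum independent set is an independent set of cardinality $\alpha(G)$. For a positive integer $p$, a graph $G$ belongs to the class $\mathbf{W}_p$ if $n(G)\geq p$ and, for every collection of $p$ pairwise disjoint independent sets $A_1,\ldots,A_p$ in $G$, there exist $p$ pairwise disjoint maximum independent sets $S_1,\ldots,S_p$ of $G$ such that $A_i\subseteq S_i$ for all $1\leq i\leq p$. For a vertex $x$, $N_G[x]$ is the set consisting of $x$ and its neighbors in $G$, and $G_x=G-N_G[x]$ is the subgraph of $G$ induced on $V(G)\setminus N_G[x]$. *)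

theory Defs
  imports Graph_Theory.Digraph_Component "HOL-Library.Disjoint_Sets"
begin

text \<open>
  The locale \<^locale>\<open>graph\<close> describes finite, loopless digraphs without multiple arcs whose
  adjacency relation is symmetric, i.e. finite simple undirected graphs.
\<close>

definition independent_set :: "('a,'b) pre_digraph \<Rightarrow> 'a set \<Rightarrow> bool" where
  "independent_set G S \<longleftrightarrow> S \<subseteq> verts G \<and> (\<forall>u\<in>S. \<forall>v\<in>S. \<not> u \<rightarrow>\<^bsub>G\<^esub> v)"

definition independence_number :: "('a,'b) pre_digraph \<Rightarrow> nat" where
  "independence_number G = Max {card S | S. independent_set G S}"

definition max_independent_set :: "('a,'b) pre_digraph \<Rightarrow> 'a set \<Rightarrow> bool" where
  "max_independent_set G S \<longleftrightarrow> independent_set G S \<and> card S = independence_number G"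

text \<open>
  Collections of \<open>p\<close> sets are families indexed by \<open>{1..p}\<close>, so the empty set may occur in
  them more than once.
\<close>

definition class_W :: "nat \<Rightarrow> ('a,'b) pre_digraph set" where
  "class_W p = {G. graph G \<and> card (verts G) \<ge> p \<and>
     (\<forall>A :: nat \<Rightarrow> 'a set.
        (\<forall>i\<in>{1..p}. independent_set G (A i)) \<and> disjoint_family_on A {1..p} \<longrightarrow>
        (\<exists>S :: nat \<Rightarrow> 'a set.
           (\<forall>i\<in>{1..p}. max_independent_set G (S i) \<and> A i \<subseteq> S i) \<and>
           disjoint_family_on S {1..p}))}"

definition closed_neighborhood :: "('a,'b) pre_digraph \<Rightarrow> 'a \<Rightarrow> 'a set" where
  "closed_neighborhood G x = insert x {y \<in> verts G. x \<rightarrow>\<^bsub>G\<^esub> y}"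

definition delete_closed_neighborhood ::
    "('a,'b) pre_digraph \<Rightarrow> 'a \<Rightarrow> ('a,'b) pre_digraph" where
  "delete_closed_neighborhood G x = G \<restriction> (verts G - closed_neighborhood G x)"

end

theory Submission
  imports Defs
begin

text \<open>
  Membership in \<open>\<^bold>W\<^sub>p\<close> is equivalent to a condition on single independent sets: whenever \<open>A\<close> is
  independent but not of maximum size, some clique of \<open>p\<close> vertices consists of vertices each of
  which can be added to \<open>A\<close> (lemma \<open>class_W_iff_clique_extendable\<close>, for graphs that have a vertex).

  Given the condition, \<open>p\<close> disjoint independent sets grow greedily to maximum size. If \<open>A\<^sub>i\<close> is too
  small, the other \<open>p - 1\<close> sets meet its clique of \<open>p\<close> candidates in at most one vertex each, so
  some candidate is still free. Conversely, for \<open>G\<close> in \<open>\<^bold>W\<^sub>p\<close> enlarge \<open>A\<close> to an independent set \<open>B\<close>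
  one vertex short of the maximum. The vertices that can be added to \<open>B\<close> form a clique, and there
  are at least \<open>p\<close> of them: if they were fewer, then \<open>p - 1\<close> singletons could exhaust them, and \<open>B\<close>
  would have no maximum extension disjoint from the extensions of these singletons.

  The condition passes between \<open>G\<close> and the graphs \<open>G\<^sub>x\<close> with no effort, because an independent set
  \<open>B\<close> of \<open>G\<^sub>x\<close> has the same candidates in \<open>G\<^sub>x\<close> as \<open>insert x B\<close> has in \<open>G\<close>. Only the empty set of
  \<open>G\<close> does not arise as \<open>insert x B\<close>; it is served by a clique of any \<open>G\<^sub>x\<close>, and such a clique
  exists because \<open>\<alpha>(G\<^sub>x) \<ge> 1\<close>.
\<close>

section \<open>Independent sets and their extensions\<close>

definition extensions :: "('a,'b) pre_digraph \<Rightarrow> 'a set \<Rightarrow> 'a set" where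
  "extensions G A = {v. v \<notin> A \<and> independent_set G (insert v A)}"

definition clique :: "('a,'b) pre_digraph \<Rightarrow> 'a set \<Rightarrow> bool" where
  "clique G K \<longleftrightarrow> (\<forall>u\<in>K. \<forall>v\<in>K. u \<noteq> v \<longrightarrow> u \<rightarrow>\<^bsub>G\<^esub> v)"

definition clique_extendable :: "nat \<Rightarrow> ('a,'b) pre_digraph \<Rightarrow> bool" where
  "clique_extendable p G \<longleftrightarrow>
     (\<forall>A. independent_set G A \<and> card A < independence_number G \<longrightarrow>
        (\<exists>K \<subseteq> extensions G A. clique G K \<and> p \<le> card K))"

lemma independent_set_empty [simp]: "independent_set G {}"
  by (simp add: independent_set_def)

lemma independent_set_subset:
  "independent_set G S \<Longrightarrow> T \<subseteq> S \<Longrightarrow> independent_set G T"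
  by (auto simp: independent_set_def)

lemma independent_set_finite:
  assumes "graph G" "independent_set G S"
  shows "finite S"
proof -
  interpret graph G by fact
  show ?thesis using assms(2) finite_verts by (auto simp: independent_set_def intro: finite_subset)
qed

lemma extensions_subset_verts: "extensions G A \<subseteq> verts G"
  by (auto simp: extensions_def independent_set_def)

lemma extensions_antimono: "A \<subseteq> B \<Longrightarrow> extensions G B \<subseteq> extensions G A"
  unfolding extensions_def by (blast intro: independent_set_subset[OF _ insert_mono])

lemma finite_card_independent_sets:
  assumes "graph G"
  shows "finite {card S | S. independent_set G S}"
proof -
  interpret graph G by fact
  have "{card S | S. independent_set G S} \<subseteq> card ` Pow (verts G)"
    by (auto simp: independent_set_def)
  thus ?thesis using finite_verts by (meson finite_Pow_iff finite_imageI finite_subset)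
qed

lemma card_le_independence_number:
  assumes "graph G" "independent_set G S"
  shows "card S \<le> independence_number G"
  unfolding independence_number_def
  using finite_card_independent_sets[OF assms(1)] assms(2) by (intro Max_ge) auto

lemma max_independent_set_exists:
  assumes "graph G"
  shows "\<exists>S. max_independent_set G S"
proof -
  have "Max {card S | S. independent_set G S} \<in> {card S | S. independent_set G S}"
    by (rule Max_in[OF finite_card_independent_sets[OF assms]]) (auto intro: exI[of _ "{}"])
  thus ?thesis by (auto simp: max_independent_set_def independence_number_def)
qed

lemma independent_set_insert_iff:
  assumes "graph G"
  shows "independent_set G (insert v A) \<longleftrightarrow>
           v \<in> verts G \<and> independent_set G A \<and> (\<forall>u\<in>A. \<not> v \<rightarrow>\<^bsub>G\<^esub> u)"
proof -
  interpret graph G by fact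
  have "\<not> v \<rightarrow>\<^bsub>G\<^esub> v" using adj_not_same by (rule notI)
  moreover have "u \<rightarrow>\<^bsub>G\<^esub> v \<longleftrightarrow> v \<rightarrow>\<^bsub>G\<^esub> u" for u using graph_symmetric by blast
  ultimately show ?thesis unfolding independent_set_def by blast
qed

lemma clique_inter_independent_set:
  assumes "clique G K" "independent_set G A" "u \<in> K" "v \<in> K" "u \<in> A" "v \<in> A"
  shows "u = v"
  using assms unfolding clique_def independent_set_def by blast

section \<open>A characterization by single independent sets\<close>

text \<open>
  Two non-adjacent extending vertices could be added together, which would exceed the
  independence number.
\<close>

lemma clique_extensions:
  assumes "graph G" "independent_set G B" "Suc (card B) = independence_number G"
  shows "clique G (extensions G B)"
  unfolding clique_def
proof (intro ballI impI, rule ccontr)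
  fix u v assume u: "u \<in> extensions G B" and v: "v \<in> extensions G B"
    and neq: "u \<noteq> v" and nadj: "\<not> u \<rightarrow>\<^bsub>G\<^esub> v"
  have "independent_set G (insert u (insert v B))"
    using u v nadj by (auto simp: extensions_def independent_set_insert_iff[OF assms(1)])
  from card_le_independence_number[OF assms(1) this]
  have "card (insert u (insert v B)) \<le> independence_number G" .
  moreover have "card (insert u (insert v B)) = Suc (Suc (card B))"
    using u v neq independent_set_finite[OF assms(1,2)] by (auto simp: extensions_def)
  ultimately show False using assms(3) by simp
qed

lemma class_W_extend_family:
  assumes "G \<in> class_W p" "\<forall>i\<in>{1..p}. independent_set G (A i)" "disjoint_family_on A {1..p}"
  shows "\<exists>S. (\<forall>i\<in>{1..p}. max_independent_set G (S i) \<and> A i \<subseteq> S i) \<and>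
             disjoint_family_on S {1..p}"
  using assms by (simp add: class_W_def)

lemma class_W_extend_to_max:
  assumes "p \<ge> 1" "G \<in> class_W p" "independent_set G A"
  shows "\<exists>S. max_independent_set G S \<and> A \<subseteq> S"
proof -
  let ?A = "\<lambda>i::nat. if i = 1 then A else {}"
  have "\<forall>i\<in>{1..p}. independent_set G (?A i)" "disjoint_family_on ?A {1..p}"
    using assms(3) by (auto simp: disjoint_family_on_def)
  from class_W_extend_family[OF assms(2) this]
  obtain S where "\<forall>i\<in>{1..p}. max_independent_set G (S i) \<and> ?A i \<subseteq> S i"
    by blast
  thus ?thesis using assms(1) by (intro exI[of _ "S 1"]) force
qed

text \<open>
  Fewer than \<open>p\<close> extending vertices can be placed in \<open>p - 1\<close> singletons. A maximum independent set
  that contains \<open>B\<close> must use one of these vertices, so it meets the maximum independent set that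
  contains the singleton of that vertex.
\<close>

lemma class_W_card_extensions:
  assumes "p \<ge> 1" "G \<in> class_W p" "independent_set G B" "card B < independence_number G"
  shows "p \<le> card (extensions G B)"
proof (rule ccontr)
  assume "\<not> p \<le> card (extensions G B)"
  hence small: "card (extensions G B) < p" by simp
  have gr: "graph G" using assms(2) by (simp add: class_W_def)
  interpret graph G by (rule gr)
  have "finite (extensions G B)" by (rule finite_subset[OF extensions_subset_verts finite_verts])
  then obtain e where e: "bij_betw e {1..card (extensions G B)} (extensions G B)"
    using ex_bij_betw_nat_finite_1 by blast
  define m where "m = card (extensions G B)"
  \<comment> \<open>The set \<open>B\<close> takes index \<open>p\<close>, which the enumeration of the extending vertices leaves free.\<close>
  define A where "A = (\<lambda>i. if i = p then B else if i \<in> {1..m} then {e i} else {})"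
  have e_ext: "e i \<in> extensions G B" if "i \<in> {1..m}" for i
    using bij_betwE[OF e] that unfolding m_def by blast
  have e_inj: "i = j" if "i \<in> {1..m}" "j \<in> {1..m}" "e i = e j" for i j
    using inj_onD[OF bij_betw_imp_inj_on[OF e]] that unfolding m_def by blast
  have "\<forall>i\<in>{1..p}. independent_set G (A i)"
    using assms(3) e_ext independent_set_subset[of G "insert (e i) B" "{e i}" for i]
    by (simp add: A_def extensions_def)
  moreover have "disjoint_family_on A {1..p}"
  proof (unfold disjoint_family_on_def, intro ballI impI, rule ccontr)
    fix i j assume "i \<noteq> j" "A i \<inter> A j \<noteq> {}"
    then obtain u where "u \<in> A i" "u \<in> A j" by blast
    thus False
      using \<open>i \<noteq> j\<close> e_inj[of i j] e_ext[of i] e_ext[of j]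
      by (simp add: A_def extensions_def split: if_splits)
  qed
  ultimately obtain S where S: "\<And>i. i \<in> {1..p} \<Longrightarrow> max_independent_set G (S i) \<and> A i \<subseteq> S i"
    and disj: "disjoint_family_on S {1..p}"
    using class_W_extend_family[OF assms(2), of A] by blast
  have Sp: "max_independent_set G (S p)" "B \<subseteq> S p"
    using S[of p] assms(1) by (auto simp: A_def)
  have "B \<noteq> S p" using Sp assms(4) by (auto simp: max_independent_set_def)
  then obtain v where v: "v \<in> S p" "v \<notin> B" using Sp by blast
  have "independent_set G (insert v B)"
    by (rule independent_set_subset[of G "S p"]) (use Sp v in \<open>auto simp: max_independent_set_def\<close>)
  hence "v \<in> extensions G B" using v by (simp add: extensions_def)
  then obtain i where i: "i \<in> {1..m}" "v = e i"
    using bij_betw_imp_surj_on[OF e] unfolding m_def by blast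
  have "i < p" using i small by (simp add: m_def)
  hence "v \<in> S i" using S[of i] i by (auto simp: A_def)
  moreover have "S i \<inter> S p = {}"
    by (rule disjoint_family_onD[OF disj]) (use i(1) \<open>i < p\<close> in auto)
  ultimately show False using v(1) by blast
qed

lemma class_W_imp_clique_extendable:
  assumes "p \<ge> 1" "G \<in> class_W p"
  shows "clique_extendable p G"
  unfolding clique_extendable_def
proof (intro allI impI, elim conjE)
  fix A assume A: "independent_set G A" "card A < independence_number G"
  have gr: "graph G" using assms(2) by (simp add: class_W_def)
  obtain S where S: "max_independent_set G S" "A \<subseteq> S"
    using class_W_extend_to_max[OF assms A(1)] by blast
  have "A \<noteq> S" using S A by (auto simp: max_independent_set_def)
  then obtain v where v: "v \<in> S" "v \<notin> A" using S by blast
  define B where "B = S - {v}"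
  have "finite S" using S gr independent_set_finite by (auto simp: max_independent_set_def)
  hence cB: "Suc (card B) = independence_number G"
    using S v card_Suc_Diff1[of S v] by (simp add: B_def max_independent_set_def)
  have B: "independent_set G B"
    using S by (auto simp: B_def max_independent_set_def intro: independent_set_subset)
  have "extensions G B \<subseteq> extensions G A"
    by (rule extensions_antimono) (use S v in \<open>auto simp: B_def\<close>)
  moreover have "clique G (extensions G B)" by (rule clique_extensions[OF gr B cB])
  moreover have "p \<le> card (extensions G B)"
    using class_W_card_extensions[OF assms B] cB by simp
  ultimately show "\<exists>K \<subseteq> extensions G A. clique G K \<and> p \<le> card K" by blast
qed

text \<open>
  A set of the family cannot contain two vertices of the clique that extends \<open>A i\<close>, and \<open>A i\<close>
  contains none. The remaining \<open>p - 1\<close> sets therefore miss a vertex of the clique.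
\<close>

lemma free_extension_exists:
  assumes "clique_extendable p G" "i \<in> {1..p}"
    and "\<forall>j\<in>{1..p}. independent_set G (A j)" "card (A i) < independence_number G"
  shows "\<exists>v \<in> extensions G (A i). \<forall>j\<in>{1..p}. v \<notin> A j"
proof (rule ccontr)
  assume none: "\<not> ?thesis"
  obtain K where K: "K \<subseteq> extensions G (A i)" "clique G K" "p \<le> card K"
    using assms unfolding clique_extendable_def by blast
  have "\<forall>v\<in>K. \<exists>j. j \<in> {1..p} \<and> v \<in> A j" using none K by blast
  then obtain f where f: "\<And>v. v \<in> K \<Longrightarrow> f v \<in> {1..p} \<and> v \<in> A (f v)" by metis
  have "inj_on f K"
  proof (rule inj_onI)
    fix u v assume "u \<in> K" "v \<in> K" "f u = f v"
    thus "u = v"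
      using clique_inter_independent_set[OF K(2), of "A (f u)" u v] f[of u] f[of v] assms(3) by simp
  qed
  moreover have "f ` K \<subseteq> {1..p} - {i}" using f K(1) unfolding extensions_def by blast
  ultimately have "card K \<le> card ({1..p} - {i})" by (intro card_inj_on_le) auto
  thus False using K(3) assms(2) by auto
qed

lemma clique_extendable_extend_family:
  assumes "graph G" "clique_extendable p G"
    and "\<forall>i\<in>{1..p}. independent_set G (A i)" "disjoint_family_on A {1..p}"
  shows "\<exists>S. (\<forall>i\<in>{1..p}. max_independent_set G (S i) \<and> A i \<subseteq> S i) \<and>
             disjoint_family_on S {1..p}"
  using assms(3,4)
proof (induction "\<Sum>i\<in>{1..p}. independence_number G - card (A i)" arbitrary: A
       rule: less_induct)
  case less
  note ind = less.prems(1) and disj = less.prems(2)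
  show ?case
  proof (cases "\<forall>i\<in>{1..p}. max_independent_set G (A i)")
    case True
    thus ?thesis using disj by blast
  next
    case False
    then obtain i where i: "i \<in> {1..p}" "\<not> max_independent_set G (A i)" by blast
    have small: "card (A i) < independence_number G"
      using i ind card_le_independence_number[OF assms(1)]
      by (meson le_neq_implies_less max_independent_set_def)
    obtain v where v: "v \<in> extensions G (A i)" "\<forall>j\<in>{1..p}. v \<notin> A j"
      using free_extension_exists[OF assms(2) i(1) ind small] by blast
    define A' where "A' = A(i := insert v (A i))"
    have cA: "card (insert v (A i)) = Suc (card (A i))"
      using v i ind independent_set_finite[OF assms(1)] by simp
    have "(\<Sum>j\<in>{1..p}. independence_number G - card (A' j))
        < (\<Sum>j\<in>{1..p}. independence_number G - card (A j))"
    proof (rule sum_strict_mono_ex1)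
      show "\<forall>j\<in>{1..p}. independence_number G - card (A' j) \<le> independence_number G - card (A j)"
        using cA by (auto simp: A'_def)
      show "\<exists>j\<in>{1..p}. independence_number G - card (A' j) < independence_number G - card (A j)"
        using cA small i by (intro bexI[of _ i]) (auto simp: A'_def)
    qed simp
    moreover have "\<forall>j\<in>{1..p}. independent_set G (A' j)"
      using ind v(1) by (auto simp: A'_def extensions_def)
    moreover have "disjoint_family_on A' {1..p}"
      using disj v(2) by (auto simp: A'_def disjoint_family_on_def)
    ultimately obtain S where S: "\<forall>j\<in>{1..p}. max_independent_set G (S j) \<and> A' j \<subseteq> S j"
      "disjoint_family_on S {1..p}"
      using less.hyps[of A'] by blast
    have "A j \<subseteq> A' j" for j by (auto simp: A'_def)
    thus ?thesis using S by (meson order_trans)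
  qed
qed

lemma class_W_iff_clique_extendable:
  assumes "graph G" "p \<ge> 1" "independence_number G \<ge> 1"
  shows "G \<in> class_W p \<longleftrightarrow> clique_extendable p G"
proof
  assume "G \<in> class_W p"
  thus "clique_extendable p G" by (rule class_W_imp_clique_extendable[OF assms(2)])
next
  assume ext: "clique_extendable p G"
  interpret graph G by fact
  have "independent_set G {} \<and> card {} < independence_number G" using assms(3) by simp
  then obtain K where "K \<subseteq> extensions G {}" "p \<le> card K"
    using ext unfolding clique_extendable_def by blast
  hence "p \<le> card (verts G)"
    using extensions_subset_verts[of G "{}"] card_mono[OF finite_verts] by (meson order_trans)
  thus "G \<in> class_W p"
    using assms(1) clique_extendable_extend_family[OF assms(1) ext]
    by (simp add: class_W_def)
qed

section \<open>Deleting a closed neighborhood\<close>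

lemma graph_delete_closed_neighborhood:
  assumes "graph G"
  shows "graph (delete_closed_neighborhood G x)"
proof -
  interpret graph G by fact
  have sub: "induced_subgraph (delete_closed_neighborhood G x) G"
    unfolding delete_closed_neighborhood_def by (rule induced_induce) blast
  show ?thesis
    using digraph.graphI[OF digraphI_induced[OF sub] induced_graph_imp_symmetric[OF sym_arcs sub]] .
qed

lemma adj_induce_subgraph:
  "u \<rightarrow>\<^bsub>G \<restriction> W\<^esub> v \<longleftrightarrow> u \<in> W \<and> v \<in> W \<and> u \<rightarrow>\<^bsub>G\<^esub> v"
  by (auto simp: arcs_ends_conv)

text \<open>The independent sets of \<open>G\<^sub>x\<close> form the link of \<open>x\<close> among the independent sets of \<open>G\<close>.\<close>

lemma independent_set_delete_closed_neighborhood: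
  assumes "graph G" "x \<in> verts G"
  shows "independent_set (delete_closed_neighborhood G x) B \<longleftrightarrow>
           x \<notin> B \<and> independent_set G (insert x B)"
  unfolding independent_set_insert_iff[OF assms(1)]
  using assms(2)
  by (auto simp: independent_set_def delete_closed_neighborhood_def closed_neighborhood_def
      adj_induce_subgraph)

lemma extensions_delete_closed_neighborhood:
  assumes "graph G" "x \<in> verts G" "x \<notin> B"
  shows "extensions (delete_closed_neighborhood G x) B = extensions G (insert x B)"
  using assms
  by (auto simp: extensions_def independent_set_delete_closed_neighborhood insert_commute)

lemma clique_delete_closed_neighborhood:
  assumes "K \<subseteq> verts (delete_closed_neighborhood G x)"
  shows "clique (delete_closed_neighborhood G x) K \<longleftrightarrow> clique G K"
  using assms
  by (auto simp: clique_def delete_closed_neighborhood_def adj_induce_subgraph)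

text \<open>
  Removing \<open>x\<close> from a maximum independent set leaves an independent set of \<open>G\<^sub>x\<close>, and adding \<open>x\<close> to
  one of \<open>G\<^sub>x\<close> gives one of \<open>G\<close>. In \<open>\<^bold>W\<^sub>p\<close> with \<open>p \<ge> 1\<close> every vertex lies in a maximum
  independent set.
\<close>

lemma independence_number_delete_closed_neighborhood:
  assumes "graph G" "x \<in> S" "max_independent_set G S"
  shows "independence_number (delete_closed_neighborhood G x) = independence_number G - 1"
proof (rule antisym)
  let ?H = "delete_closed_neighborhood G x"
  note gH = graph_delete_closed_neighborhood[OF assms(1), of x]
  have S: "independent_set G S" "card S = independence_number G"
    using assms(3) by (auto simp: max_independent_set_def)
  have x: "x \<in> verts G" using S assms(2) by (auto simp: independent_set_def)
  note ind_iff = independent_set_delete_closed_neighborhood[OF assms(1) x]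
  have "insert x (S - {x}) = S" using assms(2) by blast
  hence "independent_set ?H (S - {x})" using S by (simp add: ind_iff)
  from card_le_independence_number[OF gH this]
  show "independence_number G - 1 \<le> independence_number ?H"
    using S assms(2) independent_set_finite[OF assms(1) S(1)] by simp
  obtain T where T: "max_independent_set ?H T" using max_independent_set_exists[OF gH] by blast
  hence "independent_set ?H T" by (simp add: max_independent_set_def)
  hence xT: "x \<notin> T" "independent_set G (insert x T)" by (auto simp: ind_iff)
  have "finite T" using independent_set_finite[OF assms(1) xT(2)] by simp
  hence "Suc (card T) \<le> independence_number G"
    using card_le_independence_number[OF assms(1) xT(2)] xT(1) by simp
  thus "independence_number ?H \<le> independence_number G - 1"
    using T by (simp add: max_independent_set_def)
qed

text \<open>
  Every nonempty independent set of \<open>G\<close> is an independent set of some \<open>G\<^sub>x\<close> with \<open>x\<close> added, and the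
  two have the same extending cliques. The bound \<open>\<alpha>(G) \<ge> 2\<close> serves the empty set alone: it provides
  a vertex \<open>x\<close> such that the empty set is not maximum in \<open>G\<^sub>x\<close>.
\<close>

lemma clique_extendable_iff_delete_closed_neighborhood:
  assumes "graph G" "independence_number G \<ge> 2"
    and num: "\<And>x. x \<in> verts G \<Longrightarrow>
      independence_number (delete_closed_neighborhood G x) = independence_number G - 1"
  shows "clique_extendable p G \<longleftrightarrow>
           (\<forall>x\<in>verts G. clique_extendable p (delete_closed_neighborhood G x))"
proof -
  have transfer: "(\<exists>K \<subseteq> extensions (delete_closed_neighborhood G x) B.
                      clique (delete_closed_neighborhood G x) K \<and> p \<le> card K) \<longleftrightarrow>
                  (\<exists>K \<subseteq> extensions G (insert x B). clique G K \<and> p \<le> card K)"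
    if "x \<in> verts G" "x \<notin> B" for x B
    using extensions_delete_closed_neighborhood[OF assms(1) that]
      clique_delete_closed_neighborhood extensions_subset_verts
    by (metis order_trans)
  have card_insert: "card (insert x B) = Suc (card B)"
    if "x \<notin> B" "independent_set G (insert x B)" for x B
    using that independent_set_finite[OF assms(1) that(2)] by simp
  show ?thesis
  proof
    assume ext: "clique_extendable p G"
    show "\<forall>x\<in>verts G. clique_extendable p (delete_closed_neighborhood G x)"
    proof
      fix x assume x: "x \<in> verts G"
      show "clique_extendable p (delete_closed_neighborhood G x)"
        unfolding clique_extendable_def
      proof (intro allI impI, elim conjE)
        fix B assume "independent_set (delete_closed_neighborhood G x) B"
          and small: "card B < independence_number (delete_closed_neighborhood G x)"
        hence B: "x \<notin> B" "independent_set G (insert x B)"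
          by (auto simp: independent_set_delete_closed_neighborhood[OF assms(1) x])
        have "card (insert x B) < independence_number G"
          using small card_insert[OF B] num[OF x] by simp
        thus "\<exists>K \<subseteq> extensions (delete_closed_neighborhood G x) B.
                clique (delete_closed_neighborhood G x) K \<and> p \<le> card K"
          using ext B(2) transfer[OF x B(1)] unfolding clique_extendable_def by blast
      qed
    qed
  next
    assume ext: "\<forall>x\<in>verts G. clique_extendable p (delete_closed_neighborhood G x)"
    have step: "\<exists>K \<subseteq> extensions G (insert x B). clique G K \<and> p \<le> card K"
      if x: "x \<notin> B" "independent_set G (insert x B)" and small: "Suc (card B) < independence_number G"
      for x B
    proof -
      have xG: "x \<in> verts G" using x(2) by (simp add: independent_set_def)
      have "independent_set (delete_closed_neighborhood G x) B"
        using x by (simp add: independent_set_delete_closed_neighborhood[OF assms(1) xG])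
      moreover have "card B < independence_number (delete_closed_neighborhood G x)"
        using small num[OF xG] by simp
      ultimately show ?thesis
        using ext xG transfer[OF xG x(1)] unfolding clique_extendable_def by blast
    qed
    show "clique_extendable p G" unfolding clique_extendable_def
    proof (intro allI impI, elim conjE)
      fix A assume A: "independent_set G A" "card A < independence_number G"
      show "\<exists>K \<subseteq> extensions G A. clique G K \<and> p \<le> card K"
      proof (cases "A = {}")
        case True
        obtain S where S: "max_independent_set G S"
          using max_independent_set_exists[OF assms(1)] by blast
        hence "S \<noteq> {}" using assms(2) by (auto simp: max_independent_set_def)
        then obtain x where "x \<in> S" by blast
        hence "independent_set G {x}"
          using S by (auto simp: max_independent_set_def intro: independent_set_subset)
        hence "\<exists>K \<subseteq> extensions G {x}. clique G K \<and> p \<le> card K"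
          using step[of x "{}"] assms(2) by simp
        thus ?thesis using True extensions_antimono[of "{}" "{x}" G] by blast
      next
        case False
        then obtain x where x: "x \<in> A" by blast
        hence eq: "insert x (A - {x}) = A" by blast
        have "Suc (card (A - {x})) = card A"
          by (rule card_Suc_Diff1[OF independent_set_finite[OF assms(1) A(1)] x])
        thus ?thesis using step[of x "A - {x}"] A eq by simp
      qed
    qed
  qed
qed

theorem theorem3p2:
  fixes p :: nat and G :: "('a,'b) pre_digraph"
  assumes "p \<ge> 1" and "graph G" and "independence_number G \<ge> 2"
  shows "G \<in> class_W p \<longleftrightarrow>
    (\<forall>x\<in>verts G. delete_closed_neighborhood G x \<in> class_W p \<and>
       independence_number (delete_closed_neighborhood G x) = independence_number G - 1)"
proof -
  have main: "G \<in> class_W p \<longleftrightarrow> (\<forall>x\<in>verts G. delete_closed_neighborhood G x \<in> class_W p)"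
    if num: "\<forall>x\<in>verts G.
      independence_number (delete_closed_neighborhood G x) = independence_number G - 1"
  proof -
    have "delete_closed_neighborhood G x \<in> class_W p \<longleftrightarrow>
            clique_extendable p (delete_closed_neighborhood G x)" if "x \<in> verts G" for x
      using class_W_iff_clique_extendable[OF graph_delete_closed_neighborhood[OF assms(2)] assms(1)]
        num that assms(3) by simp
    thus ?thesis
      using class_W_iff_clique_extendable[OF assms(2,1)] assms(3) num
        clique_extendable_iff_delete_closed_neighborhood[OF assms(2,3), of p] by simp
  qed
  have "independence_number (delete_closed_neighborhood G x) = independence_number G - 1"
    if G: "G \<in> class_W p" and x: "x \<in> verts G" for x
  proof -
    have "independent_set G {x}" using x by (simp add: independent_set_insert_iff[OF assms(2)])
    then obtain S where "max_independent_set G S" "x \<in> S"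
      using class_W_extend_to_max[OF assms(1) G] by blast
    thus ?thesis using independence_number_delete_closed_neighborhood[OF assms(2)] by blast
  qed
  thus ?thesis using main by blast
qed

end
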